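(* Let $\Omega\subseteq\mathbb{R}^n$ and $f:\Omega\to\mathbb{R}^n$, and let $G\subseteq\Omega$ be forward invariant, where for each $x\in G$ the solution $\phi_f(x,t)$ of $\dot x=f(x)$ starting at $x$ exists uniquely for all $t\ge 0$ and depends continuously on the initial condition. Let $p>0$, $k>0$, $M\geq 1$, and suppose that $f$ is rationally stable on $G$ with power $p$, rate $k$, and gain $M$. Then, for every $\bar{k}\in[0,k)$, there exists a continuous function $V:G\to\mathbb{R}_+$ such that, for all $x\in G$, $$M^{-1}\|x\|_2^p\leq V(x)\leq\|x\|_2^p,\qquad \dot V(x)\leq-\bar{k}V(x)^2 .$$
   Context: $\mathbb{R}_+:=[0,\infty)$. For a vector field $f:\Omega\to\mathbb{R}^n$ on $\Omega\subseteq\mathbb{R}^n$, $\phi_f(x,t)$ denotes the solution at time $t$ of the ODE initialized at $x$: $\frac{\partial}{\partial t}\phi_f(x,t)=f(\phi_f(x,t))$, $\phi_f(x,0)=x$. Standing assumption: the solutions under consideration exist uniquely for all $t\in\mathbb{R}_+$ and depend continuously on their initial conditions, in the usual sense (uniformly on compact time intervals), so that $(x,t)\mapsto\phi_f(x,t)$ is continuous on $G\times\mathbb{R}_+$; by uniqueness, $\phi_f(\phi_f(x,t),s)=\phi_f(x,t+s)$ for $t,s\geq 0$. A set $G\subseteq\Omega$ is forward invariant if $x\in G$ implies $\phi_f(x,t)\in G$ for all $t\geq0$. For continuous $V$, $\dot V(x):=\limsup_{\Delta t\to0^+}\frac{V(\phi_f(x,\Delta t))-V(x)}{\Delta t}$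 (upper right-hand Dini derivative along solutions). For $p,k>0$ and $M\geq 1$, $f$ is rationally stable on $G$ with power $p$, rate $k$, and gain $M$ if $\|\phi_f(x,t)\|_2^p\leq M\frac{\|x\|_2^p}{1+\|x\|_2^p kt}$ for all $x\in G$ and $t\geq0$. *)

theory Defs
  imports "HOL-Analysis.Analysis"
begin

text \<open>
  The vector field \<open>f : \<Omega> \<rightarrow> \<real>\<^sup>n\<close> is a total function of which only the values on
  \<open>\<Omega>\<close> matter: a solution has to stay in \<open>\<Omega>\<close>. At \<open>t = 0\<close> the derivative is one-sided.
\<close>

definition is_solution ::
  "(real^'n) set \<Rightarrow> (real^'n \<Rightarrow> real^'n) \<Rightarrow> real^'n \<Rightarrow> (real \<Rightarrow> real^'n) \<Rightarrow> bool" where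
  "is_solution \<Omega> f x u \<longleftrightarrow>
     u 0 = x \<and>
     (\<forall>t\<ge>0. u t \<in> \<Omega> \<and> (u has_vector_derivative f (u t)) (at t within {0..}))"

text \<open>Uniqueness is only up to the irrelevant values of \<open>u\<close> at negative times.\<close>

definition unique_solution ::
  "(real^'n) set \<Rightarrow> (real^'n \<Rightarrow> real^'n) \<Rightarrow> real^'n \<Rightarrow> bool" where
  "unique_solution \<Omega> f x \<longleftrightarrow>
     (\<exists>u. is_solution \<Omega> f x u \<and> (\<forall>v. is_solution \<Omega> f x v \<longrightarrow> (\<forall>t\<ge>0. v t = u t)))"

text \<open>Meaningful only if \<open>unique_solution \<Omega> f x\<close> and \<open>t \<ge> 0\<close>; unspecified otherwise.\<close>

definition flow ::
  "(real^'n) set \<Rightarrow> (real^'n \<Rightarrow> real^'n) \<Rightarrow> real^'n \<Rightarrow> real \<Rightarrow> real^'n" where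
  "flow \<Omega> f x t = (THE y. \<exists>u. is_solution \<Omega> f x u \<and> u t = y)"

lemma flow_eq:
  assumes "unique_solution \<Omega> f x" "is_solution \<Omega> f x u" "t \<ge> 0"
  shows "flow \<Omega> f x t = u t"
  unfolding flow_def
proof (rule the_equality)
  show "\<exists>v. is_solution \<Omega> f x v \<and> v t = u t"
    using assms(2) by blast
next
  fix y assume "\<exists>v. is_solution \<Omega> f x v \<and> v t = y"
  then show "y = u t"
    using assms unfolding unique_solution_def by metis
qed

text \<open>Continuous dependence on the initial condition, uniformly on compact time intervals.\<close>

definition continuous_dependence ::
  "(real^'n) set \<Rightarrow> (real^'n \<Rightarrow> real^'n) \<Rightarrow> (real^'n) set \<Rightarrow> bool" where
  "continuous_dependence \<Omega> f G \<longleftrightarrow>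
     (\<forall>x\<in>G. \<forall>T\<ge>0. uniform_limit {0..T} (flow \<Omega> f) (flow \<Omega> f x) (at x within G))"

definition forward_invariant ::
  "(real^'n) set \<Rightarrow> (real^'n \<Rightarrow> real^'n) \<Rightarrow> (real^'n) set \<Rightarrow> bool" where
  "forward_invariant \<Omega> f G \<longleftrightarrow> (\<forall>x\<in>G. \<forall>t\<ge>0. flow \<Omega> f x t \<in> G)"

text \<open>
  The upper right-hand Dini derivative of \<open>V\<close> along solutions. It may be infinite, hence is taken
  in the extended reals.
\<close>

definition dini_along ::
  "(real^'n) set \<Rightarrow> (real^'n \<Rightarrow> real^'n) \<Rightarrow> (real^'n \<Rightarrow> real) \<Rightarrow> real^'n \<Rightarrow> ereal" where
  "dini_along \<Omega> f V x =
     Limsup (at_right 0) (\<lambda>h. ereal ((V (flow \<Omega> f x h) - V x) / h))"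

definition rationally_stable ::
  "(real^'n) set \<Rightarrow> (real^'n \<Rightarrow> real^'n) \<Rightarrow> (real^'n) set \<Rightarrow> real \<Rightarrow> real \<Rightarrow> real \<Rightarrow> bool" where
  "rationally_stable \<Omega> f G p k M \<longleftrightarrow>
     (\<forall>x\<in>G. \<forall>t\<ge>0.
        norm (flow \<Omega> f x t) powr p \<le> M * (norm x powr p / (1 + norm x powr p * k * t)))"

end

theory Submission
  imports Defs
begin

text \<open>
  Write \<open>w x t = \<parallel>\<phi>(x,t)\<parallel>\<^sup>p\<close>. Rational stability says \<open>M / w x t \<ge> 1 / w x 0 + k t\<close>, which suggests
  defining the Lyapunov function through its reciprocal, \<open>1 / V x = inf\<^sub>t (M / w x t - kbar t)\<close>:
  along a solution this infimum grows at least at rate \<open>kbar\<close>. To cover the value \<open>w x t = 0\<close>, we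
  use the equivalent form \<open>V x = sup\<^sub>t (w x t / (M - kbar t w x t))\<close>, whose denominators are
  bounded below by \<open>M (1 - kbar / k) > 0\<close>. The family under the supremum is Lipschitz in \<open>w\<close> and
  decays like \<open>1 / t\<close> uniformly in \<open>x\<close>, so it depends on \<open>x\<close> uniformly in \<open>t \<ge> 0\<close>, and the
  supremum is continuous.
\<close>

section \<open>Suprema, uniform limits and Dini derivatives\<close>

lemma abs_cSUP_diff_le:
  fixes f g :: "'a \<Rightarrow> real"
  assumes "A \<noteq> {}" "bdd_above (f ` A)" "bdd_above (g ` A)"
    and le: "\<And>t. t \<in> A \<Longrightarrow> \<bar>f t - g t\<bar> \<le> e"
  shows "\<bar>(SUP t\<in>A. f t) - (SUP t\<in>A. g t)\<bar> \<le> e"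
proof -
  have "(SUP t\<in>A. f t) \<le> (SUP t\<in>A. g t) + e"
  proof (rule cSUP_least[OF assms(1)])
    fix t assume t: "t \<in> A"
    show "f t \<le> (SUP t\<in>A. g t) + e"
      using le[OF t] cSUP_upper[OF t assms(3)] by linarith
  qed
  moreover have "(SUP t\<in>A. g t) \<le> (SUP t\<in>A. f t) + e"
  proof (rule cSUP_least[OF assms(1)])
    fix t assume t: "t \<in> A"
    show "g t \<le> (SUP t\<in>A. f t) + e"
      using le[OF t] cSUP_upper[OF t assms(2)] by linarith
  qed
  ultimately show ?thesis by linarith
qed

text \<open>For \<open>p > 1\<close> the map \<open>s powr p\<close> is not uniformly continuous on
  the half-line. The bound \<open>R\<close> on the limit confines all relevant norms to a compact
  interval, where it is.\<close>

lemma uniform_limit_norm_powr: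
  fixes u :: "'a \<Rightarrow> 'b \<Rightarrow> 'c::real_normed_vector"
  assumes lim: "uniform_limit S u l F"
    and p: "p > 0"
    and bd: "\<And>t. t \<in> S \<Longrightarrow> norm (l t) \<le> R"
  shows "uniform_limit S (\<lambda>y t. norm (u y t) powr p) (\<lambda>t. norm (l t) powr p) F"
proof (rule uniform_limitI)
  fix e :: real assume e: "e > 0"
  \<comment> \<open>The endpoint 0 is where \<open>p > 0\<close> matters:
    \<open>0 powr p = 0\<close> is then the limit value.\<close>
  have "continuous_on {0..R + 1} (\<lambda>s::real. s powr p)"
    using p by (intro continuous_on_powr') auto
  then have "uniformly_continuous_on {0..R + 1} (\<lambda>s::real. s powr p)"
    by (intro compact_uniformly_continuous) auto
  then obtain d where d: "d > 0"
    and ud: "\<And>s s'. s \<in> {0..R + 1} \<Longrightarrow> s' \<in> {0..R + 1} \<Longrightarrow> dist s' s < d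
               \<Longrightarrow> dist (s' powr p) (s powr p) < e"
    unfolding uniformly_continuous_on_def using e by metis
  \<comment> \<open>The 1 in the minimum keeps \<open>norm (u y t)\<close> below
    \<open>R + 1\<close>.\<close>
  have "\<forall>\<^sub>F y in F. \<forall>t\<in>S. dist (u y t) (l t) < min d 1"
    using uniform_limitD[OF lim, of "min d 1"] d by simp
  then show "\<forall>\<^sub>F y in F. \<forall>t\<in>S. dist (norm (u y t) powr p) (norm (l t) powr p) < e"
  proof (rule eventually_mono, intro ballI)
    fix y t assume close: "\<forall>t\<in>S. dist (u y t) (l t) < min d 1" and t: "t \<in> S"
    have *: "\<bar>norm (u y t) - norm (l t)\<bar> < min d 1"
      using close t norm_triangle_ineq3[of "u y t" "l t"] by (force simp: dist_norm)
    show "dist (norm (u y t) powr p) (norm (l t) powr p) < e"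
      using * bd[OF t] by (intro ud) (auto simp: dist_real_def)
  qed
qed

text \<open>For positive \<open>a\<close> and \<open>v h\<close> the hypothesis reads
  \<open>1 / v h \<ge> 1 / a + c * h\<close>; this form also covers the value 0. It bounds the
  difference quotient by an explicit function of \<open>h\<close> that converges to the right-hand
  side.\<close>

lemma Limsup_le_of_reciprocal_growth:
  fixes v :: "real \<Rightarrow> real"
  assumes "c \<ge> 0" "a \<ge> 0"
    and le: "\<And>h. h > 0 \<Longrightarrow> v h \<le> a / (1 + c * h * a)"
  shows "Limsup (at_right 0) (\<lambda>h. ereal ((v h - a) / h)) \<le> ereal (- c * a\<^sup>2)"
proof -
  have "((\<lambda>h. - c * a\<^sup>2 / (1 + c * h * a)) \<longlongrightarrow> - c * a\<^sup>2 / (1 + c * 0 * a)) (at_right 0)"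
    by (intro tendsto_intros) auto
  then have lim: "((\<lambda>h. ereal (- c * a\<^sup>2 / (1 + c * h * a))) \<longlongrightarrow> ereal (- c * a\<^sup>2)) (at_right 0)"
    by simp
  have bound: "(v h - a) / h \<le> - c * a\<^sup>2 / (1 + c * h * a)" if h: "h > 0" for h
  proof -
    have pos: "1 + c * h * a > 0"
      using assms h by (simp add: add_pos_nonneg)
    have "v h - a \<le> a / (1 + c * h * a) - a"
      using le[OF h] by simp
    also have "\<dots> = - c * a\<^sup>2 / (1 + c * h * a) * h"
      using pos by (simp add: field_simps power2_eq_square)
    finally show ?thesis
      using h by (simp add: pos_divide_le_eq)
  qed
  have "Limsup (at_right 0) (\<lambda>h. ereal ((v h - a) / h))
      \<le> Limsup (at_right 0) (\<lambda>h. ereal (- c * a\<^sup>2 / (1 + c * h * a)))"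
    by (intro Limsup_mono eventually_mono[OF eventually_at_right_less[of 0]])
      (use bound in \<open>simp only: ereal_less_eq\<close>)
  also have "\<dots> = ereal (- c * a\<^sup>2)"
    using lim by (intro lim_imp_Limsup) auto
  finally show ?thesis .
qed

section \<open>The semigroup law of the flow\<close>

lemma is_solution_shift:
  assumes "is_solution \<Omega> f x u" "h \<ge> 0"
  shows "is_solution \<Omega> f (u h) (\<lambda>t. u (t + h))"
  unfolding is_solution_def
proof (intro conjI allI impI)
  fix t :: real assume t: "t \<ge> 0"
  show "u (t + h) \<in> \<Omega>"
    using assms t unfolding is_solution_def by simp
  have "(u has_vector_derivative f (u (t + h))) (at (t + h) within {0..})"
    using assms t unfolding is_solution_def by simp
  \<comment> \<open>The one-sided chain rule asks for the derivative within the image of the shift,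
    which is \<open>{h..}\<close>, a subset of \<open>{0..}\<close>.\<close>
  then have "(u has_vector_derivative f (u (t + h))) (at (t + h) within (\<lambda>t. t + h) ` {0..})"
    by (rule has_vector_derivative_within_subset) (use assms(2) in auto)
  moreover have "((\<lambda>t. t + h) has_vector_derivative 1) (at t within {0..})"
    by (auto intro!: derivative_eq_intros)
  ultimately show "((\<lambda>t. u (t + h)) has_vector_derivative f (u (t + h))) (at t within {0..})"
    using vector_diff_chain_within[of "\<lambda>t. t + h" 1 t "{0..}" u] by (simp add: o_def)
qed simp

lemma flow_0:
  assumes "unique_solution \<Omega> f x"
  shows "flow \<Omega> f x 0 = x"
proof -
  obtain u where u: "is_solution \<Omega> f x u"
    using assms unfolding unique_solution_def by blast
  then have "flow \<Omega> f x 0 = u 0"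
    by (rule flow_eq[OF assms]) simp
  then show ?thesis
    using u by (simp add: is_solution_def)
qed

text \<open>The shifted solution solves the equation from \<open>flow \<Omega> f x h\<close>, so
  uniqueness at that restarted point identifies it with the flow there.\<close>

lemma flow_flow:
  assumes "unique_solution \<Omega> f x" "unique_solution \<Omega> f (flow \<Omega> f x h)" "h \<ge> 0" "t \<ge> 0"
  shows "flow \<Omega> f (flow \<Omega> f x h) t = flow \<Omega> f x (t + h)"
proof -
  obtain u where u: "is_solution \<Omega> f x u"
    using assms(1) unfolding unique_solution_def by blast
  have uh: "flow \<Omega> f x h = u h" and uth: "flow \<Omega> f x (t + h) = u (t + h)"
    using flow_eq[OF assms(1) u] assms by auto
  show ?thesis
    using flow_eq[OF assms(2)[unfolded uh] is_solution_shift[OF u assms(3)] assms(4)]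
    by (simp add: uh uth)
qed

section \<open>The Lyapunov function of a rationally decaying family\<close>

text \<open>The construction sees solutions only through the scalar \<open>w x t\<close>. Continuous
  dependence and the semigroup law enter later, as hypotheses of \<open>lyap_continuous\<close> and
  \<open>lyap_shift\<close>.\<close>

locale rational_decay =
  fixes G :: "'a::metric_space set" and w :: "'a \<Rightarrow> real \<Rightarrow> real" and k kbar M :: real
  assumes nonneg: "\<And>x t. x \<in> G \<Longrightarrow> t \<ge> 0 \<Longrightarrow> w x t \<ge> 0"
    and decay: "\<And>x t. x \<in> G \<Longrightarrow> t \<ge> 0 \<Longrightarrow> w x t \<le> M * (w x 0 / (1 + w x 0 * k * t))"
    and kbar: "0 \<le> kbar" "kbar < k"
    and M: "M \<ge> 1"
begin

definition score :: "'a \<Rightarrow> real \<Rightarrow> real" where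
  "score x t = w x t / (M - kbar * t * w x t)"

definition lyap :: "'a \<Rightarrow> real" where
  "lyap x = (SUP t\<in>{0..}. score x t)"

lemma decay_mult:
  assumes "x \<in> G" "t \<ge> 0"
  shows "w x t * (1 + w x 0 * k * t) \<le> M * w x 0"
proof -
  have "1 + w x 0 * k * t > 0"
    using assms nonneg[of x 0] kbar by (simp add: add_pos_nonneg)
  then show ?thesis
    using decay[OF assms] by (simp add: field_simps)
qed

text \<open>Dropping the summand \<open>w x t\<close> in \<open>decay_mult\<close> and cancelling
  \<open>w x 0\<close> leaves a bound free of the initial value. This is the source of all
  uniformity in \<open>x\<close>.\<close>

lemma rate_bound:
  assumes "x \<in> G" "t \<ge> 0"
  shows "k * t * w x t \<le> M"
proof (cases "w x 0 = 0")
  case True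
  then have "w x t = 0"
    using decay_mult[OF assms] nonneg[OF assms] by simp
  then show ?thesis using M by simp
next
  case False
  then have r: "w x 0 > 0"
    using nonneg[of x 0] assms by simp
  have "w x 0 * (k * t * w x t) \<le> w x 0 * M"
    using decay_mult[OF assms] nonneg[OF assms] by (simp add: algebra_simps)
  then show ?thesis using r by simp
qed

text \<open>The value of the denominator of \<open>score\<close> in the extreme case
  \<open>k * t * w x t = M\<close> of \<open>rate_bound\<close>; it is positive because
  \<open>kbar < k\<close> is strict.\<close>

definition gap :: real where "gap = M * (1 - kbar / k)"

lemma gap_pos: "gap > 0"
  using kbar M by (simp add: gap_def)

lemma denominator_ge:
  assumes "x \<in> G" "t \<ge> 0"
  shows "gap \<le> M - kbar * t * w x t"
proof -
  have "kbar / k * (k * t * w x t) \<le> kbar / k * M"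
    using rate_bound[OF assms] kbar by (intro mult_left_mono) auto
  then show ?thesis
    using kbar by (simp add: gap_def algebra_simps)
qed

lemma score_nonneg:
  assumes "x \<in> G" "t \<ge> 0"
  shows "score x t \<ge> 0"
  unfolding score_def
  using nonneg[OF assms] denominator_ge[OF assms] gap_pos by simp

text \<open>In reciprocals: \<open>M / w x t - kbar * t \<ge> 1 / w x 0 + (k - kbar) * t \<ge> 1 / w
  x 0\<close>.\<close>

lemma score_le_initial:
  assumes "x \<in> G" "t \<ge> 0"
  shows "score x t \<le> w x 0"
proof -
  have "kbar * (w x 0 * t * w x t) \<le> k * (w x 0 * t * w x t)"
    using kbar nonneg[OF assms] nonneg[of x 0] assms by (intro mult_right_mono) auto
  then have "w x t \<le> w x 0 * (M - kbar * t * w x t)"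
    using decay_mult[OF assms] by (simp add: algebra_simps)
  then show ?thesis
    unfolding score_def using denominator_ge[OF assms] gap_pos by (simp add: pos_divide_le_eq)
qed

text \<open>The bound does not depend on \<open>x\<close>, so for continuity only a compact range of
  times has to be compared.\<close>

lemma score_tail:
  assumes "x \<in> G" "T > 0" "t \<ge> T"
  shows "score x t \<le> M / (k * T * gap)"
proof -
  have t: "t \<ge> 0" using assms by simp
  have "k * T * w x t \<le> k * t * w x t"
    using assms kbar nonneg[OF assms(1) t] by (intro mult_right_mono) auto
  then have "w x t * (k * T) \<le> M"
    using rate_bound[OF assms(1) t] by (simp add: mult.commute)
  then have "w x t \<le> M / (k * T)"
    using kbar assms by (simp add: pos_le_divide_eq)
  then have "score x t \<le> M / (k * T) / gap"
    unfolding score_def using denominator_ge[OF assms(1) t] gap_pos nonneg[OF assms(1) t]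
    by (intro frac_le) auto
  then show ?thesis by simp
qed

lemma score_lipschitz:
  assumes "x \<in> G" "y \<in> G" "t \<ge> 0"
  shows "\<bar>score y t - score x t\<bar> \<le> M / gap\<^sup>2 * \<bar>w y t - w x t\<bar>"
proof -
  define a b where "a = M - kbar * t * w x t" and "b = M - kbar * t * w y t"
  have a: "gap \<le> a" and b: "gap \<le> b"
    using denominator_ge assms by (auto simp: a_def b_def)
  \<comment> \<open>The cross terms \<open>kbar * t * w x t * w y t\<close> cancel, so
    \<open>t\<close> disappears from the numerator and the Lipschitz constant is uniform in
    \<open>t\<close>.\<close>
  have "score y t - score x t = M * (w y t - w x t) / (a * b)"
    using a b gap_pos unfolding score_def a_def b_def
    by (simp add: divide_simps) (simp add: algebra_simps)
  then have "\<bar>score y t - score x t\<bar> = M * \<bar>w y t - w x t\<bar> / (a * b)"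
    using a b gap_pos M by (simp add: abs_mult)
  also have "\<dots> \<le> M * \<bar>w y t - w x t\<bar> / gap\<^sup>2"
    using a b gap_pos M unfolding power2_eq_square
    by (intro divide_left_mono mult_mono) auto
  finally show ?thesis by simp
qed

lemma bdd_above_score:
  assumes "x \<in> G"
  shows "bdd_above (score x ` {0..})"
  using score_le_initial[OF assms] by (auto intro!: bdd_aboveI)

lemma score_le_lyap:
  assumes "x \<in> G" "t \<ge> 0"
  shows "score x t \<le> lyap x"
  unfolding lyap_def using assms by (intro cSUP_upper bdd_above_score) auto

lemma lyap_nonneg:
  assumes "x \<in> G"
  shows "lyap x \<ge> 0"
  using score_nonneg[OF assms, of 0] score_le_lyap[OF assms, of 0] by simp

lemma lyap_le:
  assumes "x \<in> G"
  shows "lyap x \<le> w x 0"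
  unfolding lyap_def using score_le_initial[OF assms] by (intro cSUP_least) auto

text \<open>The time 0 competes in the supremum, with score \<open>w x 0 / M\<close>.\<close>

lemma lyap_ge:
  assumes "x \<in> G"
  shows "inverse M * w x 0 \<le> lyap x"
  using score_le_lyap[OF assms, of 0] by (simp add: score_def field_simps)

lemma lyap_continuous:
  assumes lim: "\<And>x T. x \<in> G \<Longrightarrow> T \<ge> 0 \<Longrightarrow> uniform_limit {0..T} w (w x) (at x within G)"
  shows "continuous_on G lyap"
  unfolding continuous_on_def
proof (intro ballI tendstoI)
  fix x and e :: real assume x: "x \<in> G" and e: "e > 0"
  \<comment> \<open>Chosen so that the bound of \<open>score_tail\<close> equals
    \<open>e / 2\<close>; likewise \<open>d\<close> below makes the bound of
    \<open>score_lipschitz\<close> equal to \<open>e / 2\<close>.\<close>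
  define T where "T = 2 * M / (k * gap * e)"
  have T: "T > 0"
    using M kbar gap_pos e by (simp add: T_def)
  have tail: "M / (k * T * gap) = e / 2"
    using M kbar gap_pos e by (simp add: T_def field_simps)
  define d where "d = e / 2 * (gap\<^sup>2 / M)"
  have d: "d > 0" and Md: "M / gap\<^sup>2 * d = e / 2"
    using M gap_pos e by (auto simp: d_def)
  have "\<forall>\<^sub>F y in at x within G. \<forall>t\<in>{0..T}. dist (w y t) (w x t) < d"
    using uniform_limitD[OF lim[OF x] d] T by simp
  moreover have "\<forall>\<^sub>F y in at x within G. y \<in> G"
    by (simp add: eventually_at_filter)
  ultimately show "\<forall>\<^sub>F y in at x within G. dist (lyap y) (lyap x) < e"
  proof eventually_elim
    fix y assume close: "\<forall>t\<in>{0..T}. dist (w y t) (w x t) < d" and y: "y \<in> G"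
    have "\<bar>lyap y - lyap x\<bar> \<le> e / 2"
      unfolding lyap_def
    proof (rule abs_cSUP_diff_le)
      fix t :: real assume "t \<in> {0..}"
      then have t: "t \<ge> 0" by simp
      show "\<bar>score y t - score x t\<bar> \<le> e / 2"
      proof (cases "t \<le> T")
        case True
        then have "\<bar>w y t - w x t\<bar> \<le> d"
          using close t by (force simp: dist_real_def)
        then have "M / gap\<^sup>2 * \<bar>w y t - w x t\<bar> \<le> M / gap\<^sup>2 * d"
          using M by (intro mult_left_mono) auto
        then show ?thesis
          using score_lipschitz[OF x y t] Md by linarith
      next
        \<comment> \<open>Both scores lie between 0 and \<open>e / 2\<close>, hence so does their
          distance.\<close>
        case False
        then show ?thesis
          using score_tail[OF x T, of t] score_tail[OF y T, of t]
            score_nonneg[OF x t] score_nonneg[OF y t] tail by linarith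
      qed
    qed (use x y bdd_above_score in auto)
    then show "dist (lyap y) (lyap x) < e"
      using e by (simp add: dist_real_def)
  qed
qed

text \<open>Where \<open>w\<close> is positive,
  \<open>1 / score y t = 1 / score x (t + h) + kbar * h\<close>: the same value of \<open>w\<close>
  is reached with \<open>h\<close> less elapsed time. Moreover \<open>y\<close> sees only the times
  from \<open>h\<close> on, which can only lower the supremum.\<close>

lemma lyap_shift:
  assumes x: "x \<in> G" and y: "y \<in> G" and h: "h \<ge> 0"
    and shift: "\<And>t. t \<ge> 0 \<Longrightarrow> w y t = w x (t + h)"
  shows "lyap y \<le> lyap x / (1 + kbar * h * lyap x)"
  unfolding lyap_def[of y]
proof (rule cSUP_least)
  fix t :: real assume "t \<in> {0..}"
  then have t: "t \<ge> 0" and th: "t + h \<ge> 0" using h by auto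
  define v where "v = score x (t + h)"
  have v: "0 \<le> v" "v \<le> lyap x"
    using score_nonneg[OF x th] score_le_lyap[OF x th] by (auto simp: v_def)
  have ch: "0 \<le> kbar * h" using kbar h by simp
  have pos: "M - kbar * (t + h) * w x (t + h) > 0"
    using denominator_ge[OF x th] gap_pos by linarith
  have pos': "M - kbar * t * w x (t + h) > 0"
    using denominator_ge[OF y t] gap_pos shift[OF t] by simp
  have "1 + kbar * h * v = (M - kbar * t * w x (t + h)) / (M - kbar * (t + h) * w x (t + h))"
    using pos by (simp add: v_def score_def field_simps)
  then have "score y t = v / (1 + kbar * h * v)"
    using pos pos' by (simp add: v_def score_def shift[OF t])
  \<comment> \<open>For \<open>c \<ge> 0\<close> the map \<open>s / (1 + c * s)\<close> is
    increasing in \<open>s \<ge> 0\<close>.\<close>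
  also have "\<dots> \<le> lyap x / (1 + kbar * h * lyap x)"
  proof -
    have "1 + kbar * h * v > 0" "1 + kbar * h * lyap x > 0"
      using ch v by (auto intro!: add_pos_nonneg mult_nonneg_nonneg[OF ch])
    then show ?thesis
      using v(2) by (simp add: divide_le_eq pos_le_divide_eq algebra_simps)
  qed
  finally show "score y t \<le> lyap x / (1 + kbar * h * lyap x)" .
qed simp

end

section \<open>Application to the flow\<close>

theorem theorem8:
  fixes \<Omega> G :: "(real^'n) set" and f :: "real^'n \<Rightarrow> real^'n" and p k M :: real
  assumes "G \<subseteq> \<Omega>"
    and "\<forall>x\<in>G. unique_solution \<Omega> f x"
    and "continuous_dependence \<Omega> f G"
    and "forward_invariant \<Omega> f G"
    and "p > 0" and "k > 0" and "M \<ge> 1"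
    and "rationally_stable \<Omega> f G p k M"
  shows "\<forall>kbar\<in>{0..<k}. \<exists>V :: real^'n \<Rightarrow> real.
    continuous_on G V \<and>
    (\<forall>x\<in>G. V x \<ge> 0 \<and>
      inverse M * norm x powr p \<le> V x \<and> V x \<le> norm x powr p \<and>
      dini_along \<Omega> f V x \<le> ereal (- kbar * (V x)\<^sup>2))"
proof
  fix kbar assume "kbar \<in> {0..<k}"
  then have kbar: "0 \<le> kbar" "kbar < k" by auto
  define w where "w = (\<lambda>x t. norm (flow \<Omega> f x t) powr p)"
  have w0: "w x 0 = norm x powr p" if "x \<in> G" for x
    using that assms(2) by (simp add: w_def flow_0)
  interpret rational_decay G w k kbar M
  proof
    fix x and t :: real assume x: "x \<in> G" and t: "t \<ge> 0"
    show "w x t \<le> M * (w x 0 / (1 + w x 0 * k * t))"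
      using assms(8) x t unfolding rationally_stable_def w0[OF x] by (simp add: w_def)
  qed (use kbar assms in \<open>auto simp: w_def\<close>)
  have "continuous_on G lyap"
  proof (rule lyap_continuous)
    fix x and T :: real assume x: "x \<in> G" and T: "T \<ge> 0"
    show "uniform_limit {0..T} w (w x) (at x within G)"
      unfolding w_def
    proof (rule uniform_limit_norm_powr)
      show "uniform_limit {0..T} (flow \<Omega> f) (flow \<Omega> f x) (at x within G)"
        using assms(3) x T by (auto simp: continuous_dependence_def)
      fix t assume "t \<in> {0..T}"
      then have t: "t \<ge> 0" by simp
      \<comment> \<open>The radius required by \<open>uniform_limit_norm_powr\<close>: without its
        decaying factor, stability gives \<open>w x t \<le> M * w x 0\<close>, and taking
        \<open>p\<close>-th roots bounds the trajectory.\<close>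
      have "w x t * 1 \<le> w x t * (1 + w x 0 * k * t)"
        using nonneg[OF x t] nonneg[OF x order_refl] kbar t by (intro mult_left_mono) auto
      then have "w x t \<le> M * w x 0"
        using decay_mult[OF x t] by simp
      then have "w x t powr (1 / p) \<le> (M * w x 0) powr (1 / p)"
        using \<open>p > 0\<close> nonneg[OF x t] by (intro powr_mono2) auto
      then show "norm (flow \<Omega> f x t) \<le> (M * w x 0) powr (1 / p)"
        using \<open>p > 0\<close> by (simp add: w_def powr_powr)
    qed (rule \<open>p > 0\<close>)
  qed
  moreover have "dini_along \<Omega> f lyap x \<le> ereal (- kbar * (lyap x)\<^sup>2)" if x: "x \<in> G" for x
    unfolding dini_along_def
  proof (rule Limsup_le_of_reciprocal_growth)
    fix h :: real assume h: "h > 0"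
    have y: "flow \<Omega> f x h \<in> G"
      using assms(4) x h by (auto simp: forward_invariant_def)
    show "lyap (flow \<Omega> f x h) \<le> lyap x / (1 + kbar * h * lyap x)"
      \<comment> \<open>Forward invariance puts the restarted point in \<open>G\<close>, so
        uniqueness holds there and \<open>flow_flow\<close> supplies the shift hypothesis.\<close>
      using x y h assms(2) by (intro lyap_shift) (auto simp: w_def flow_flow)
  qed (use kbar lyap_nonneg[OF x] in auto)
  ultimately show "\<exists>V :: real^'n \<Rightarrow> real.
    continuous_on G V \<and>
    (\<forall>x\<in>G. V x \<ge> 0 \<and>
      inverse M * norm x powr p \<le> V x \<and> V x \<le> norm x powr p \<and>
      dini_along \<Omega> f V x \<le> ereal (- kbar * (V x)\<^sup>2))"
    using lyap_nonneg lyap_ge lyap_le w0 by (intro exI[of _ lyap]) auto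
qed

end
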